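(* Consider, in the benchmark model described in the context, any sequence of environments indexed by $m\in\mathbb{N}$ such that, along the sequence, all $b_i$ lie in an interval $[\underline b,\overline b]$ with $\overline b\ge\underline b>0$, all $f_{ij}$ lie in an interval $[\underline f,\overline f]$ with $\overline f\ge\underline f>0$, $\rho$ is bounded away from zero, and the budgets $\mathcal B$ are bounded above. Suppose the corresponding sequence of zero-subsidy networks $\{\boldsymbol G_m^{(0)}\}_{m\in\mathbb N}$ satisfies: 1. (Uniform primitivity) there exist $L\in\mathbb N$ and $\delta>0$ such that for every $m$, entrywise, $$\frac{(\boldsymbol G_m^{(0)})^L}{(\mu_1(\boldsymbol G_m^{(0)}))^L}\ge\delta\,\boldsymbol 1\boldsymbol 1^\top,$$ where $\mu_1(\cdot)$ denotes spectral radius; and 2. $\lim_{m\to\infty}\mu_1(\rho\,\boldsymbol G_m^{(0)})=1$ (with $\rho$ the complementarity parameter of environment $m$). Then for all $m$ large enough, any optimal subsidy $(\boldsymbol\beta^*,\boldsymbol\sigma^* )$ in environment $m$ has $\beta_i^*=0$ for every agent $i\in\mathcal N$.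
   Context: **Benchmark model (an environment).** There are agents $\mathcal N=\{1,\dots,n\}$. Parameters: $b_i>0$, $\rho>0$, $s_{ij}=s_{ji}\in\mathbb R$, $f_{ij}=f_{ji}>0$, a budget $\mathcal B>0$, and a welfare function $\mathcal W(\boldsymbol a)$ that is differentiable and strictly increasing in each argument. A planner commits to a subsidy $(\boldsymbol\beta,\boldsymbol\sigma)$ with $\beta_i\ge0$ and $\sigma_{ij}\ge0$ ($i\ne j$, not necessarily symmetric). First, each agent $i$ publicly chooses link intensities $g_{ij}\ge0$, $j\ne i$, each chosen to maximize $s_{ij}G_{ij}+\sigma_{ij}G_{ij}-\frac{f_{ij}g_{ij}^2}{2}$, where $G_{ij}=G_{ji}=g_{ij}+g_{ji}$ and $G_{ii}=0$ (agents ignore payoffs of the subsequent game when choosing links). Then, given $\boldsymbol G$, agents simultaneously choose actions $a_i\ge0$ with payoffs $$\mathcal U_i=(b_i+\beta_i)a_i+\rho\sum_{j\ne i}G_{ij}a_ia_j-\frac{a_i^2}{2}.$$ An equilibrium $(\boldsymbol a^*,\boldsymbol g^* )$ consists of link intensities that are optimal in the first stage and a pure strategy Nash equilibrium $\boldsymbol a^*$ of the action game under the resulting network $\boldsymbol G^*$. An equilibrium selection is fixed; welfare is set to $-\infty$ for subsidies with no equilibrium. The planner's payment is $\mathcal P=\sum_i\beta_ia_i^*+\sum_i\sum_{j\ne i}\sigma_{ij}G_{ij}^*$. A subsidy is optimal if an equilibrium exists under it, $\mathcal P\le\mathcal B$, and it maximizes $\mathcal W(\boldsymbol a^* )$ among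 all subsidies satisfying $\mathcal P\le\mathcal B$ at the selected equilibrium. **Zero-subsidy network.** For environment $m$, $\boldsymbol G_m^{(0)}$ is the equilibrium network $\boldsymbol G^*$ under $(\boldsymbol\beta,\boldsymbol\sigma)=(\boldsymbol 0,\boldsymbol 0)$. All parameters of the environment may vary with $m$ subject to the stated bounds. $\boldsymbol 1$ is the all-ones vector. *)

theory Defs
  imports "HOL-Analysis.Analysis"
begin

section \<open>Matrices\<close>

text \<open>The instance of \<open>^\<close> for vectors is the componentwise power, hence a separate
  constant for the power with respect to the matrix product.\<close>

definition mat_power :: "real^'n^'n \<Rightarrow> nat \<Rightarrow> real^'n^'n" where
  "mat_power A k = (((**) A) ^^ k) (mat 1)"

definition eigenvalues :: "real^'n^'n \<Rightarrow> complex set" where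
  "eigenvalues A = {l. \<exists>v::complex^'n. v \<noteq> 0 \<and> map_matrix complex_of_real A *v v = l *s v}"

definition spectral_radius :: "real^'n^'n \<Rightarrow> real" where
  "spectral_radius A = (SUP l\<in>eigenvalues A. cmod l)"


section \<open>Environments\<close>

text \<open>Agents are the elements of the finite type \<open>'n\<close>. An action profile is a vector \<open>a\<close>; link
  intensities \<open>g $ i $ j\<close>, the parameters \<open>s\<close> and \<open>f\<close> and the link subsidies are matrices of which
  only the off-diagonal entries have a meaning. The diagonals of link intensities and of link
  subsidies are normalised to \<open>0\<close>.
  The fixed equilibrium selection is part of the environment; it maps a subsidy
  \<open>(\<beta>, \<sigma>)\<close> to an equilibrium \<open>(a, g)\<close>, and its value is arbitrary if there is none.\<close>

record ('n::finite) env =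
  benefit :: "real^'n"
  compl :: real
  link_value :: "real^'n^'n"
  link_cost :: "real^'n^'n"
  budget :: real
  welfare :: "real^'n \<Rightarrow> real"
  selection :: "real^'n \<Rightarrow> real^'n^'n \<Rightarrow> (real^'n) \<times> (real^'n^'n)"

definition upd :: "real^'n \<Rightarrow> 'n \<Rightarrow> real \<Rightarrow> real^'n" where
  "upd a i x = (\<chi> k. if k = i then x else a $ k)"

definition action_profiles :: "(real^'n) set" where
  "action_profiles = {a. \<forall>i. 0 \<le> a $ i}"

definition link_profiles :: "(real^'n^'n) set" where
  "link_profiles = {g. (\<forall>i j. 0 \<le> g $ i $ j) \<and> (\<forall>i. g $ i $ i = 0)}"

definition subsidies :: "((real^'n) \<times> (real^'n^'n)) set" where
  "subsidies = {(\<beta>, \<sigma>). (\<forall>i. 0 \<le> \<beta> $ i) \<and> (\<forall>i j. 0 \<le> \<sigma> $ i $ j) \<and> (\<forall>i. \<sigma> $ i $ i = 0)}"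


section \<open>The two stages\<close>

definition network :: "real^'n^'n \<Rightarrow> real^'n^'n" where
  "network g = (\<chi> i j. if i = j then 0 else g $ i $ j + g $ j $ i)"

text \<open>The payoff of \<open>i\<close> from the link with \<open>j\<close>, if \<open>i\<close> contributes \<open>x\<close> and \<open>j\<close> contributes \<open>y\<close>.\<close>

definition link_payoff ::
    "'n::finite env \<Rightarrow> real^'n^'n \<Rightarrow> 'n \<Rightarrow> 'n \<Rightarrow> real \<Rightarrow> real \<Rightarrow> real" where
  "link_payoff E \<sigma> i j x y =
     link_value E $ i $ j * (x + y) + \<sigma> $ i $ j * (x + y) - link_cost E $ i $ j * x\<^sup>2 / 2"

definition optimal_links :: "'n::finite env \<Rightarrow> real^'n^'n \<Rightarrow> real^'n^'n \<Rightarrow> bool" where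
  "optimal_links E \<sigma> g \<longleftrightarrow> g \<in> link_profiles \<and>
     (\<forall>i j. i \<noteq> j \<longrightarrow> (\<forall>x\<ge>0.
        link_payoff E \<sigma> i j x (g $ j $ i) \<le> link_payoff E \<sigma> i j (g $ i $ j) (g $ j $ i)))"

definition action_payoff ::
    "'n::finite env \<Rightarrow> real^'n \<Rightarrow> real^'n^'n \<Rightarrow> real^'n \<Rightarrow> 'n \<Rightarrow> real" where
  "action_payoff E \<beta> G a i =
     (benefit E $ i + \<beta> $ i) * a $ i
     + compl E * (\<Sum>j\<in>UNIV - {i}. G $ i $ j * a $ i * a $ j) - (a $ i)\<^sup>2 / 2"

definition action_nash :: "'n::finite env \<Rightarrow> real^'n \<Rightarrow> real^'n^'n \<Rightarrow> real^'n \<Rightarrow> bool" where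
  "action_nash E \<beta> G a \<longleftrightarrow> a \<in> action_profiles \<and>
     (\<forall>i. \<forall>x\<ge>0. action_payoff E \<beta> G (upd a i x) i \<le> action_payoff E \<beta> G a i)"

definition equilibrium ::
    "'n::finite env \<Rightarrow> real^'n \<Rightarrow> real^'n^'n \<Rightarrow> real^'n \<Rightarrow> real^'n^'n \<Rightarrow> bool" where
  "equilibrium E \<beta> \<sigma> a g \<longleftrightarrow> optimal_links E \<sigma> g \<and> action_nash E \<beta> (network g) a"

definition has_equilibrium :: "'n::finite env \<Rightarrow> real^'n \<Rightarrow> real^'n^'n \<Rightarrow> bool" where
  "has_equilibrium E \<beta> \<sigma> \<longleftrightarrow> (\<exists>a g. equilibrium E \<beta> \<sigma> a g)"

definition strictly_increasing_in_each :: "(real^'n \<Rightarrow> real) \<Rightarrow> bool" where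
  "strictly_increasing_in_each w \<longleftrightarrow>
     (\<forall>a\<in>action_profiles. \<forall>i x. a $ i < x \<longrightarrow> w a < w (upd a i x))"

definition environment :: "'n::finite env \<Rightarrow> bool" where
  "environment E \<longleftrightarrow>
     (\<forall>i. 0 < benefit E $ i) \<and> 0 < compl E \<and>
     (\<forall>i j. i \<noteq> j \<longrightarrow> link_value E $ i $ j = link_value E $ j $ i) \<and>
     (\<forall>i j. i \<noteq> j \<longrightarrow> link_cost E $ i $ j = link_cost E $ j $ i \<and> 0 < link_cost E $ i $ j) \<and>
     0 < budget E \<and>
     welfare E differentiable_on action_profiles \<and>
     strictly_increasing_in_each (welfare E) \<and>
     (\<forall>(\<beta>, \<sigma>)\<in>subsidies. has_equilibrium E \<beta> \<sigma> \<longrightarrow>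
        equilibrium E \<beta> \<sigma> (fst (selection E \<beta> \<sigma>)) (snd (selection E \<beta> \<sigma>)))"


section \<open>The planner\<close>

definition eq_action :: "'n::finite env \<Rightarrow> real^'n \<Rightarrow> real^'n^'n \<Rightarrow> real^'n" where
  "eq_action E \<beta> \<sigma> = fst (selection E \<beta> \<sigma>)"

definition eq_network :: "'n::finite env \<Rightarrow> real^'n \<Rightarrow> real^'n^'n \<Rightarrow> real^'n^'n" where
  "eq_network E \<beta> \<sigma> = network (snd (selection E \<beta> \<sigma>))"

definition payment :: "'n::finite env \<Rightarrow> real^'n \<Rightarrow> real^'n^'n \<Rightarrow> real" where
  "payment E \<beta> \<sigma> =
     (\<Sum>i\<in>UNIV. \<beta> $ i * eq_action E \<beta> \<sigma> $ i)
     + (\<Sum>i\<in>UNIV. \<Sum>j\<in>UNIV - {i}. \<sigma> $ i $ j * eq_network E \<beta> \<sigma> $ i $ j)"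

definition subsidy_welfare :: "'n::finite env \<Rightarrow> real^'n \<Rightarrow> real^'n^'n \<Rightarrow> ereal" where
  "subsidy_welfare E \<beta> \<sigma> =
     (if has_equilibrium E \<beta> \<sigma> then ereal (welfare E (eq_action E \<beta> \<sigma>)) else - \<infinity>)"

text \<open>The budget constraint is only meaningful for subsidies with an equilibrium; all others have
  welfare \<open>-\<infinity>\<close>, so that it is immaterial whether they count as affordable.\<close>

definition affordable :: "'n::finite env \<Rightarrow> real^'n \<Rightarrow> real^'n^'n \<Rightarrow> bool" where
  "affordable E \<beta> \<sigma> \<longleftrightarrow> (has_equilibrium E \<beta> \<sigma> \<longrightarrow> payment E \<beta> \<sigma> \<le> budget E)"

definition optimal_subsidy :: "'n::finite env \<Rightarrow> real^'n \<Rightarrow> real^'n^'n \<Rightarrow> bool" where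
  "optimal_subsidy E \<beta> \<sigma> \<longleftrightarrow>
     (\<beta>, \<sigma>) \<in> subsidies \<and> has_equilibrium E \<beta> \<sigma> \<and> payment E \<beta> \<sigma> \<le> budget E \<and>
     (\<forall>(\<beta>', \<sigma>')\<in>subsidies. affordable E \<beta>' \<sigma>' \<longrightarrow>
        subsidy_welfare E \<beta>' \<sigma>' \<le> subsidy_welfare E \<beta> \<sigma>)"

text \<open>The network formed in the first stage under the subsidy \<open>0\<close>. Links are chosen independently
  of the action game, so this network exists (and is unique) even if the subsequent action game has
  no Nash equilibrium; if it has one, this network is \<open>eq_network E 0 0\<close>.\<close>

definition zero_subsidy_network :: "'n::finite env \<Rightarrow> real^'n^'n \<Rightarrow> bool" where
  "zero_subsidy_network E G \<longleftrightarrow> (\<exists>g. optimal_links E 0 g \<and> G = network g)"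

end

theory Submission
  imports Defs
begin

text \<open>Near criticality equilibrium actions explode: if \<open>a\<close> solves \<open>a = b + \<beta> + \<rho> G a\<close>, then
  \<open>\<rho> G0 a \<le> (1 - b_lo / S) a\<close> with \<open>S\<close> the sum of the actions, so that \<open>S\<close> is at least
  \<open>b_lo / (1 - \<mu>)\<close> with \<open>\<mu>\<close> the spectral radius of \<open>\<rho> G0\<close>, and uniform primitivity makes every
  single action a fixed fraction of \<open>S\<close>. Suppose that \<open>\<beta> $ i > 0\<close>. Some link between \<open>i\<close> and
  another agent \<open>k\<close> is active even without subsidies, and strengthening it has a bounded marginal
  cost, because a large subsidy on an active link would exhaust the budget. The complementarity
  created by this link replaces part of \<open>\<beta> $ i\<close>, and the expenditure saved on \<open>\<beta>\<close> is of the order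
  of \<open>a $ i\<close>. Hence some small substitution is affordable and raises the actions.\<close>

text \<open>At \<open>z = max 0 (c / f)\<close> complementary slackness makes every
  \<open>x \<ge> 0\<close> lose at least \<open>f / 2 * (x - z)\<^sup>2\<close>, so \<open>z\<close>
  is the only maximiser. Link choices and action choices (with \<open>f = 1\<close>) both have this
  form.\<close>

lemma quadratic_argmax_iff:
  fixes c f y :: real
  assumes "0 < f"
  shows "0 \<le> y \<and> (\<forall>x\<ge>0. c * x - f * x\<^sup>2 / 2 \<le> c * y - f * y\<^sup>2 / 2) \<longleftrightarrow> y = max 0 (c / f)"
    (is "?opt y \<longleftrightarrow> _")
proof -
  define z where "z = max 0 (c / f)"
  have z: "0 \<le> z" "c \<le> f * z" "z * (c - f * z) = 0"
    using assms by (auto simp: z_def max_def field_simps)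
  have gap: "f / 2 * (x - z)\<^sup>2 \<le> (c * z - f * z\<^sup>2 / 2) - (c * x - f * x\<^sup>2 / 2)" if "0 \<le> x" for x
  proof -
    have "(c * z - f * z\<^sup>2 / 2) - (c * x - f * x\<^sup>2 / 2) - f / 2 * (x - z)\<^sup>2
        = z * (c - f * z) + x * (f * z - c)"
      by (simp add: power2_eq_square field_simps)
    moreover have "0 \<le> x * (f * z - c)"
      using that z by simp
    ultimately show ?thesis using z by linarith
  qed
  have "?opt z"
  proof (intro conjI allI impI)
    fix x :: real assume "0 \<le> x"
    moreover have "0 \<le> f / 2 * (x - z)\<^sup>2" using assms by simp
    ultimately show "c * x - f * x\<^sup>2 / 2 \<le> c * z - f * z\<^sup>2 / 2"
      using gap[of x] by linarith
  qed (use z in simp)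
  moreover have "y = z" if "?opt y"
  proof -
    have "f / 2 * (y - z)\<^sup>2 \<le> 0"
      using gap[of y] that z by fastforce
    then show ?thesis using assms by (simp add: mult_le_0_iff)
  qed
  ultimately show ?thesis unfolding z_def[symmetric] by blast
qed


section \<open>Nonnegative matrices\<close>

lemma matrix_vector_mult_mono:
  fixes A B :: "real^'n^'n" and x y :: "real^'n"
  assumes "\<And>i j. 0 \<le> A $ i $ j" "\<And>i j. A $ i $ j \<le> B $ i $ j"
    and "\<And>j. x $ j \<le> y $ j" "\<And>j. 0 \<le> y $ j"
  shows "(A *v x) $ i \<le> (B *v y) $ i"
proof -
  have "A $ i $ j * x $ j \<le> B $ i $ j * y $ j" for j
    by (meson assms mult_left_mono mult_right_mono order_trans)
  then show ?thesis
    by (simp add: matrix_vector_mult_def sum_mono)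
qed

text \<open>Minimum principle: at an index \<open>k\<close> minimising \<open>x $ j / a $ j\<close>,
  a negative ratio \<open>r k\<close> would give
  \<open>(M *v x) $ k \<ge> r k * (M *v a) $ k > x $ k\<close>. The strictly subinvariant vector
  \<open>a\<close> takes the place of a spectral bound on \<open>M\<close>.\<close>

lemma nonneg_if_supersolution:
  fixes M :: "real^'n^'n" and a x :: "real^'n"
  assumes M: "\<And>i j. 0 \<le> M $ i $ j"
    and a: "\<And>i. 0 < a $ i" "\<And>i. (M *v a) $ i < a $ i"
    and x: "\<And>i. (M *v x) $ i \<le> x $ i"
  shows "0 \<le> x $ i"
proof -
  define r where "r j = x $ j / a $ j" for j
  obtain k where k: "\<And>j. r k \<le> r j"
    using ex_min_if_finite[of "range r"] by (auto simp: not_less)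
  have "0 \<le> r k"
  proof (rule ccontr)
    assume neg: "\<not> 0 \<le> r k"
    have "r k * a $ j \<le> x $ j" for j
      using mult_right_mono[OF k[of j], of "a $ j"] a(1)[of j] by (simp add: r_def)
    then have "(\<Sum>j\<in>UNIV. M $ k $ j * (r k * a $ j)) \<le> (\<Sum>j\<in>UNIV. M $ k $ j * x $ j)"
      using M by (intro sum_mono mult_left_mono) auto
    also have "(\<Sum>j\<in>UNIV. M $ k $ j * (r k * a $ j)) = r k * (M *v a) $ k"
      by (simp add: matrix_vector_mult_def sum_distrib_left mult_ac)
    finally have "r k * (M *v a) $ k \<le> x $ k"
      using x[of k] by (simp add: matrix_vector_mult_def)
    moreover have "r k * a $ k < r k * (M *v a) $ k"
      using neg a(2)[of k] by simp
    moreover have "r k * a $ k = x $ k"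
      using a(1)[of k] by (simp add: r_def)
    ultimately show False by linarith
  qed
  then have "0 \<le> r i" using k[of i] by linarith
  then show ?thesis using a(1)[of i] by (simp add: r_def zero_le_divide_iff)
qed

text \<open>The difference of two solutions is fixed by \<open>M\<close>, and the minimum principle
  applies to it with either sign.\<close>

lemma unique_fixed_point_if_subinvariant:
  fixes M :: "real^'n^'n" and a c x y :: "real^'n"
  assumes M: "\<And>i j. 0 \<le> M $ i $ j"
    and a: "\<And>i. 0 < a $ i" "\<And>i. (M *v a) $ i < a $ i"
    and xy: "x = c + M *v x" "y = c + M *v y"
  shows "x = y"
proof -
  have le: "0 \<le> (u - v) $ i" if "u = c + M *v u" "v = c + M *v v" for u v i
  proof -
    have "M *v (u - v) = u - v"
      using that by (metis add_diff_cancel_left matrix_vector_mult_diff_distrib)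
    then show ?thesis
      using nonneg_if_supersolution[OF M a, of "u - v"] by simp
  qed
  show ?thesis
    using le[OF xy] le[OF xy(2,1)] by (simp add: vec_eq_iff) (meson antisym)
qed

text \<open>Uniqueness makes \<open>x - M *v x\<close> injective in \<open>x\<close>, hence
  surjective in finite dimension; the minimum principle then gives the sign.\<close>

lemma ex_fixed_point_if_subinvariant:
  fixes M :: "real^'n^'n" and a c :: "real^'n"
  assumes M: "\<And>i j. 0 \<le> M $ i $ j"
    and a: "\<And>i. 0 < a $ i" "\<And>i. (M *v a) $ i < a $ i"
    and c: "\<And>i. 0 \<le> c $ i"
  obtains w where "w = c + M *v w" "\<And>i. 0 \<le> w $ i"
proof -
  have lin: "linear (\<lambda>x. x - M *v x)"
    by (intro linear_compose_sub linear_ident matrix_vector_mul_linear)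
  moreover have "inj (\<lambda>x. x - M *v x)"
  proof (rule injI)
    fix x y assume eq: "x - M *v x = y - M *v y"
    show "x = y"
    proof (rule unique_fixed_point_if_subinvariant[OF M a])
      show "x = (x - M *v x) + M *v x" by simp
      show "y = (x - M *v x) + M *v y" by (simp add: eq)
    qed
  qed
  ultimately obtain w where w: "w - M *v w = c"
    using linear_injective_imp_surjective by (metis surjD)
  then have eq: "w = c + M *v w" by (metis diff_add_cancel)
  then have "(M *v w) $ i \<le> w $ i" for i
    using c[of i] by (metis le_add_same_cancel2 vector_add_component)
  then have "0 \<le> w $ i" for i
    using nonneg_if_supersolution[OF M a] by blast
  with eq that show thesis by blast
qed

lemma mat_power_subinvariant:
  fixes A :: "real^'n^'n" and a :: "real^'n"
  assumes A: "\<And>i j. 0 \<le> A $ i $ j" and r: "0 \<le> r"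
    and a: "\<And>i. 0 \<le> a $ i" "\<And>i. r * (A *v a) $ i \<le> a $ i"
  shows "r ^ k * (mat_power A k *v a) $ i \<le> a $ i"
proof (induction k arbitrary: i)
  case 0
  then show ?case by (simp add: mat_power_def)
next
  case (Suc k)
  have "mat_power A (Suc k) *v a = A *v (mat_power A k *v a)"
    by (simp add: mat_power_def matrix_vector_mul_assoc)
  then have "r ^ Suc k * (mat_power A (Suc k) *v a) $ i = r * (A *v (r ^ k *\<^sub>R (mat_power A k *v a))) $ i"
    by (simp add: matrix_vector_mult_scaleR)
  also have "\<dots> \<le> r * (A *v a) $ i"
    using A a Suc.IH r by (intro mult_left_mono matrix_vector_mult_mono) auto
  also have "\<dots> \<le> a $ i" by (fact a(2))
  finally show ?case .
qed

lemma mat_power_zero_row: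
  fixes A :: "real^'n^'n"
  assumes "\<And>j. A $ i $ j = 0" "0 < k"
  shows "mat_power A k $ i $ j = 0"
  using assms by (cases k) (auto simp: mat_power_def matrix_matrix_mult_def)


section \<open>Spectral radius\<close>

text \<open>The spectral radius is a real supremum, which can only be bounded from above if it
  ranges over a nonempty set. For symmetric \<open>A\<close>, a maximiser of the Rayleigh quotient
  on the unit sphere is an eigenvector.\<close>

lemma eigenvalues_symmetric_nonempty:
  fixes A :: "real^'n^'n"
  assumes "transpose A = A"
  shows "eigenvalues A \<noteq> {}"
proof -
  let ?q = "\<lambda>x. x \<bullet> (A *v x)"
  have sym: "x \<bullet> (A *v y) = y \<bullet> (A *v x)" for x y
    by (metis assms dot_lmul_matrix inner_commute transpose_matrix_vector)
  have "axis undefined 1 \<in> sphere (0 :: real^'n) 1" by simp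
  then have "sphere (0 :: real^'n) 1 \<noteq> {}" by blast
  moreover have "continuous_on (sphere 0 1) ?q"
    by (intro continuous_intros linear_continuous_on matrix_vector_mul_bounded_linear)
  ultimately obtain x where x: "norm x = 1" and max: "\<And>y. norm y = 1 \<Longrightarrow> ?q y \<le> ?q x"
    using continuous_attains_sup[OF compact_sphere[of "0 :: real^'n" 1], of ?q] by auto
  define l where "l = ?q x"
  have psd: "?q y \<le> l * (y \<bullet> y)" for y
  proof (cases "y = 0")
    case False
    define u where "u = (1 / norm y) *\<^sub>R y"
    have "norm u = 1" using False by (simp add: u_def)
    then have "?q u \<le> l" using max by (simp add: l_def)
    moreover have "?q u = ?q y / (y \<bullet> y)"
      by (simp add: u_def matrix_vector_mult_scaleR norm_eq_sqrt_inner flip: power2_eq_square)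
    ultimately show ?thesis using False by (simp add: field_simps)
  qed simp
  \<comment> \<open>The form \<open>l |y|\<^sup>2 - ?q y\<close> is nonnegative and vanishes at \<open>x\<close>, hence so does its gradient there.\<close>
  define d where "d = A *v x - l *\<^sub>R x"
  have lower: "2 * (d \<bullet> d) \<le> t * (l * (d \<bullet> d) - ?q d)" if "0 < t" for t
  proof -
    have "?q (x + t *\<^sub>R d) = ?q x + 2 * t * (d \<bullet> (A *v x)) + t\<^sup>2 * ?q d"
      using sym[of x d]
      by (simp add: matrix_vector_right_distrib matrix_vector_mult_scaleR inner_simps power2_eq_square algebra_simps)
    moreover have "(x + t *\<^sub>R d) \<bullet> (x + t *\<^sub>R d) = 1 + 2 * t * (d \<bullet> x) + t\<^sup>2 * (d \<bullet> d)"
      using x by (simp add: inner_simps power2_eq_square norm_eq_1 inner_commute algebra_simps)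
    ultimately have "l + 2 * t * (d \<bullet> (A *v x)) + t\<^sup>2 * ?q d \<le> l * (1 + 2 * t * (d \<bullet> x) + t\<^sup>2 * (d \<bullet> d))"
      using psd[of "x + t *\<^sub>R d"] by (simp add: l_def)
    moreover have "d \<bullet> (A *v x) = d \<bullet> d + l * (d \<bullet> x)"
      by (subst (3) d_def) (simp add: inner_simps)
    ultimately have "l + 2 * t * (d \<bullet> d + l * (d \<bullet> x)) + t\<^sup>2 * ?q d
        \<le> l * (1 + 2 * t * (d \<bullet> x) + t\<^sup>2 * (d \<bullet> d))"
      by simp
    then have "t * (2 * (d \<bullet> d)) \<le> t * (t * (l * (d \<bullet> d) - ?q d))"
      by (simp add: power2_eq_square algebra_simps)
    then show ?thesis using that by simp
  qed
  have "d = 0"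
  proof (rule ccontr)
    assume "d \<noteq> 0"
    then have "0 < d \<bullet> d" by simp
    define c where "c = l * (d \<bullet> d) - ?q d"
    have "0 \<le> c" using psd[of d] by (simp add: c_def)
    \<comment> \<open>Small enough that \<open>2 * (d \<bullet> d) \<le> t * c\<close> fails; the
      summand 1 keeps the denominator positive when \<open>c = 0\<close>.\<close>
    define t where "t = (d \<bullet> d) / (c + 1)"
    have "0 < t" using \<open>0 < d \<bullet> d\<close> \<open>0 \<le> c\<close> by (simp add: t_def)
    moreover have "t * c \<le> d \<bullet> d"
      using \<open>0 < d \<bullet> d\<close> \<open>0 \<le> c\<close> by (simp add: t_def field_simps)
    ultimately show False
      using lower[of t] \<open>0 < d \<bullet> d\<close> by (simp add: c_def)
  qed
  then have Ax: "A *v x = l *\<^sub>R x" by (simp add: d_def)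
  define v :: "complex^'n" where "v = (\<chi> i. complex_of_real (x $ i))"
  have "(map_matrix complex_of_real A *v v) $ i = (complex_of_real l *s v) $ i" for i
  proof -
    have "(map_matrix complex_of_real A *v v) $ i = complex_of_real ((A *v x) $ i)"
      by (simp add: v_def matrix_vector_mult_def map_matrix_def)
    then show ?thesis by (simp add: Ax v_def)
  qed
  then have "map_matrix complex_of_real A *v v = complex_of_real l *s v"
    by (simp add: vec_eq_iff)
  moreover have "v \<noteq> 0"
  proof -
    have "x \<noteq> 0" using x by auto
    then show ?thesis by (simp add: v_def vec_eq_iff)
  qed
  ultimately have "complex_of_real l \<in> eigenvalues A"
    unfolding eigenvalues_def by blast
  then show ?thesis by blast
qed

text \<open>Upper Collatz-Wielandt bound: the eigenvalue equation is read at the index where the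
  eigenvector is largest relative to \<open>a\<close>.\<close>

lemma eigenvalue_le_if_subinvariant:
  fixes A :: "real^'n^'n" and a :: "real^'n"
  assumes A: "\<And>i j. 0 \<le> A $ i $ j"
    and a: "\<And>i. 0 < a $ i" "\<And>i. (A *v a) $ i \<le> r * a $ i"
    and l: "l \<in> eigenvalues A"
  shows "cmod l \<le> r"
proof -
  obtain v :: "complex^'n" where v: "v \<noteq> 0" "map_matrix complex_of_real A *v v = l *s v"
    using l by (auto simp: eigenvalues_def)
  define q where "q j = cmod (v $ j) / a $ j" for j
  obtain k where k: "\<And>j. q j \<le> q k"
    using ex_min_if_finite[of "range (\<lambda>j. - q j)"] by (auto simp: not_less)
  obtain j where "v $ j \<noteq> 0" using v(1) by (auto simp: vec_eq_iff)
  then have "0 < q j" using a(1) by (simp add: q_def)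
  then have pos: "0 < q k" using k[of j] by linarith
  have le: "cmod (v $ j) \<le> q k * a $ j" for j
    using mult_right_mono[OF k[of j], of "a $ j"] a(1)[of j] by (simp add: q_def)
  have "cmod l * (q k * a $ k) = cmod ((l *s v) $ k)"
    using a(1)[of k] by (simp add: q_def norm_mult)
  also have "\<dots> = cmod (\<Sum>j\<in>UNIV. complex_of_real (A $ k $ j) * v $ j)"
    unfolding v(2)[symmetric] by (simp add: matrix_vector_mult_def map_matrix_def)
  also have "\<dots> \<le> (\<Sum>j\<in>UNIV. A $ k $ j * cmod (v $ j))"
    by (rule order_trans[OF norm_sum]) (simp add: norm_mult A)
  also have "\<dots> \<le> (\<Sum>j\<in>UNIV. A $ k $ j * (q k * a $ j))"
    using A le by (intro sum_mono mult_left_mono) auto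
  also have "\<dots> = q k * (A *v a) $ k"
    by (simp add: matrix_vector_mult_def sum_distrib_left mult_ac)
  also have "\<dots> \<le> q k * (r * a $ k)"
    using pos a(2) by simp
  finally have "cmod l * (q k * a $ k) \<le> r * (q k * a $ k)"
    by (simp add: mult_ac)
  then show ?thesis using pos a(1)[of k] by simp
qed

lemma spectral_radius_le_if_subinvariant:
  fixes A :: "real^'n^'n" and a :: "real^'n"
  assumes "transpose A = A" "\<And>i j. 0 \<le> A $ i $ j"
    and "\<And>i. 0 < a $ i" "\<And>i. (A *v a) $ i \<le> r * a $ i"
  shows "spectral_radius A \<le> r"
  unfolding spectral_radius_def
  using eigenvalues_symmetric_nonempty[OF assms(1)] eigenvalue_le_if_subinvariant[OF assms(2-4)]
  by (rule cSUP_least)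

lemma eigenvalues_scaleR:
  assumes "r \<noteq> 0" "l \<in> eigenvalues (r *\<^sub>R A)"
  shows "l / complex_of_real r \<in> eigenvalues A"
proof -
  obtain v where v: "v \<noteq> 0" "map_matrix complex_of_real (r *\<^sub>R A) *v v = l *s v"
    using assms(2) by (auto simp: eigenvalues_def)
  have "(map_matrix complex_of_real A *v v) $ i = ((l / complex_of_real r) *s v) $ i" for i
  proof -
    have "complex_of_real r * (map_matrix complex_of_real A *v v) $ i
        = (map_matrix complex_of_real (r *\<^sub>R A) *v v) $ i"
      by (simp add: matrix_vector_mult_def map_matrix_def sum_distrib_left mult.assoc)
    then show ?thesis using assms(1) v(2) by (simp add: field_simps)
  qed
  then show ?thesis
    unfolding eigenvalues_def using v(1) by (auto simp: vec_eq_iff)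
qed

text \<open>The vector \<open>a\<close> shows that the moduli of the eigenvalues of \<open>A\<close>
  are bounded, so that their supremum dominates each of them.\<close>

lemma spectral_radius_scaleR_le:
  fixes A :: "real^'n^'n" and a :: "real^'n"
  assumes "0 < r" and A: "transpose A = A" "\<And>i j. 0 \<le> A $ i $ j"
    and a: "\<And>i. 0 < a $ i" "\<And>i. (A *v a) $ i \<le> q * a $ i"
  shows "spectral_radius (r *\<^sub>R A) \<le> r * spectral_radius A"
  unfolding spectral_radius_def[of "r *\<^sub>R A"]
proof (rule cSUP_least)
  show "eigenvalues (r *\<^sub>R A) \<noteq> {}"
    using A(1) by (intro eigenvalues_symmetric_nonempty) (simp add: transpose_def vec_eq_iff)
next
  fix l assume "l \<in> eigenvalues (r *\<^sub>R A)"
  then have "l / complex_of_real r \<in> eigenvalues A"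
    using assms(1) by (intro eigenvalues_scaleR) auto
  moreover have "bdd_above (cmod ` eigenvalues A)"
    using eigenvalue_le_if_subinvariant[OF A(2) a] by (auto intro!: bdd_aboveI)
  ultimately have "cmod (l / complex_of_real r) \<le> spectral_radius A"
    unfolding spectral_radius_def by (rule cSUP_upper)
  then show "cmod l \<le> r * spectral_radius A"
    using assms(1) by (simp add: norm_divide field_simps)
qed


text \<open>Since \<open>b\<close> is at least \<open>b / S * a $ j\<close> for the total
  \<open>S\<close> of \<open>a\<close>, applying \<open>\<rho> *\<^sub>R A\<close> shrinks
  \<open>a\<close> by the factor \<open>1 - b / S\<close>, so
  \<open>b \<le> (1 - \<mu>) * S\<close>. Applying it \<open>L\<close> times does not increase
  \<open>a\<close> either, and primitivity turns this into
  \<open>a $ i \<ge> \<delta> * \<mu> ^ L * S\<close>.\<close>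

lemma primitive_subinvariant_lower_bound:
  fixes A :: "real^'n^'n" and a :: "real^'n" and \<rho> b \<delta> :: real
  defines "\<mu> \<equiv> spectral_radius (\<rho> *\<^sub>R A)"
  assumes A: "transpose A = A" "\<And>i j. 0 \<le> A $ i $ j"
    and pos: "0 < \<rho>" "0 < b" "0 \<le> \<delta>" "0 < \<mu>"
    and prim: "\<And>i j. \<delta> \<le> mat_power A L $ i $ j / spectral_radius A ^ L"
    and a: "\<And>i. 0 < a $ i" "\<And>i. \<rho> * (A *v a) $ i + b \<le> a $ i"
  shows "\<mu> \<le> 1" "\<delta> * \<mu> ^ L * b \<le> (1 - \<mu>) * a $ i"
proof -
  let ?S = "\<Sum>j\<in>UNIV. a $ j"
  have S: "a $ j \<le> ?S" for j
    using a(1) by (intro member_le_sum) (auto intro: less_imp_le)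
  have Spos: "0 < ?S" using a(1) by (intro sum_pos) auto
  have "\<mu> \<le> 1 - b / ?S"
    unfolding \<mu>_def
  proof (rule spectral_radius_le_if_subinvariant[where a = a])
    show "transpose (\<rho> *\<^sub>R A) = \<rho> *\<^sub>R A"
      using A(1) by (simp add: transpose_def vec_eq_iff)
    show "(\<rho> *\<^sub>R A *v a) $ j \<le> (1 - b / ?S) * a $ j" for j
    proof -
      have "b / ?S * a $ j \<le> b"
        using pos(2) S[of j] Spos by (simp add: field_simps)
      then show ?thesis
        using a(2)[of j] by (simp add: algebra_simps flip: scaleR_matrix_vector_assoc)
    qed
  qed (use A a pos in auto)
  then have gap: "b \<le> (1 - \<mu>) * ?S"
    using Spos by (simp add: field_simps)
  then have "0 < (1 - \<mu>) * ?S" using pos(2) by linarith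
  then show "\<mu> \<le> 1" using Spos by (simp add: zero_less_mult_iff)
  have Aa: "(A *v a) $ j \<le> (1 / \<rho>) * a $ j" for j
    using a(2)[of j] pos by (simp add: field_simps)
  \<comment> \<open>Primitivity is normalised by the spectral radius of \<open>A\<close>, whereas
    \<open>\<mu>\<close> is that of \<open>\<rho> *\<^sub>R A\<close>. This inequality links the two
    and makes the former positive.\<close>
  have \<mu>_le: "\<mu> \<le> \<rho> * spectral_radius A"
    unfolding \<mu>_def using pos(1) A a(1) Aa by (rule spectral_radius_scaleR_le)
  then have sr: "0 < spectral_radius A"
    using pos by (metis less_le_trans zero_less_mult_pos)
  have "\<delta> * \<mu> ^ L \<le> \<rho> ^ L * mat_power A L $ i $ j" for j
  proof -
    have "\<delta> * \<mu> ^ L \<le> \<delta> * (\<rho> * spectral_radius A) ^ L"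
      using \<mu>_le pos by (intro mult_left_mono power_mono) auto
    also have "\<dots> = \<rho> ^ L * (\<delta> * spectral_radius A ^ L)"
      by (simp add: power_mult_distrib)
    also have "\<dots> \<le> \<rho> ^ L * mat_power A L $ i $ j"
      using prim[of i j] sr pos by (intro mult_left_mono) (simp_all add: pos_le_divide_eq)
    finally show ?thesis .
  qed
  then have "(\<Sum>j\<in>UNIV. \<delta> * \<mu> ^ L * a $ j) \<le> (\<Sum>j\<in>UNIV. \<rho> ^ L * mat_power A L $ i $ j * a $ j)"
    using a(1) by (intro sum_mono mult_right_mono) (auto intro: less_imp_le)
  also have "\<dots> = \<rho> ^ L * (mat_power A L *v a) $ i"
    by (simp add: matrix_vector_mult_def sum_distrib_left mult.assoc)
  also have "\<dots> \<le> a $ i"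
  proof (rule mat_power_subinvariant[OF A(2)])
    show "\<rho> * (A *v a) $ j \<le> a $ j" for j
      using a(2)[of j] pos(2) by linarith
  qed (use pos a in \<open>auto intro: less_imp_le\<close>)
  finally have comparable: "\<delta> * \<mu> ^ L * ?S \<le> a $ i"
    by (simp add: sum_distrib_left)
  have "\<delta> * \<mu> ^ L * b \<le> \<delta> * \<mu> ^ L * ((1 - \<mu>) * ?S)"
    using gap pos by (intro mult_left_mono) auto
  also have "\<dots> = (1 - \<mu>) * (\<delta> * \<mu> ^ L * ?S)" by simp
  also have "\<dots> \<le> (1 - \<mu>) * a $ i"
    using comparable \<open>\<mu> \<le> 1\<close> by (intro mult_left_mono) auto
  finally show "\<delta> * \<mu> ^ L * b \<le> (1 - \<mu>) * a $ i" .
qed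


section \<open>Equilibria\<close>

lemma welfare_mono:
  fixes W :: "real^'n \<Rightarrow> real"
  assumes W: "strictly_increasing_in_each W" and a: "a \<in> action_profiles" "\<And>i. a $ i \<le> a' $ i"
  shows "W a \<le> W a'"
proof -
  \<comment> \<open>The hybrid profile that has moved from \<open>a\<close> to \<open>a'\<close> on
    \<open>S\<close> only; raising one coordinate at a time reaches \<open>a'\<close>.\<close>
  define m where "m S = (\<chi> i. if i \<in> S then a' $ i else a $ i)" for S
  have "W a \<le> W (m S)" if "finite S" for S
    using that
  proof induction
    case empty
    then show ?case by (simp add: m_def)
  next
    case (insert k S)
    have upd: "m (insert k S) = upd (m S) k (a' $ k)"
      by (auto simp: m_def upd_def vec_eq_iff)
    have "m S \<in> action_profiles"
      using a(1) order_trans[OF _ a(2)] by (simp add: m_def action_profiles_def)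
    moreover have "m S $ k = a $ k" using insert by (simp add: m_def)
    moreover have "upd (m S) k (m S $ k) = m S" by (simp add: upd_def vec_eq_iff)
    ultimately have "W (m S) \<le> W (m (insert k S))"
      using W a(2)[of k] unfolding upd strictly_increasing_in_each_def
      by (metis less_eq_real_def)
    then show ?case using insert by linarith
  qed
  from this[of UNIV] show ?thesis by (simp add: m_def)
qed

lemma welfare_strict_mono:
  fixes W :: "real^'n \<Rightarrow> real"
  assumes W: "strictly_increasing_in_each W"
    and a: "a \<in> action_profiles" "\<And>i. a $ i \<le> a' $ i" "a $ k < a' $ k"
  shows "W a < W a'"
proof -
  have "W a < W (upd a k (a' $ k))"
    using W a(1,3) unfolding strictly_increasing_in_each_def by blast
  also have "\<dots> \<le> W a'"
  proof (rule welfare_mono[OF W])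
    show "upd a k (a' $ k) \<in> action_profiles"
      using a by (fastforce simp: upd_def action_profiles_def intro: order_trans)
    show "upd a k (a' $ k) $ i \<le> a' $ i" for i
      using a(2) by (simp add: upd_def)
  qed
  finally show ?thesis .
qed

text \<open>The partner's contribution enters a link payoff additively and cancels, so each
  intensity solves its own quadratic problem.\<close>

lemma optimal_links_iff:
  assumes f: "\<And>i j. i \<noteq> j \<Longrightarrow> 0 < link_cost E $ i $ j"
  shows "optimal_links E \<sigma> g \<longleftrightarrow> (\<forall>i j. g $ i $ j =
    (if i = j then 0 else max 0 ((link_value E $ i $ j + \<sigma> $ i $ j) / link_cost E $ i $ j)))"
proof -
  have "optimal_links E \<sigma> g \<longleftrightarrow> (\<forall>i j. (i = j \<longrightarrow> g $ i $ j = 0) \<and> (i \<noteq> j \<longrightarrow> 0 \<le> g $ i $ j \<and>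
      (\<forall>x\<ge>0. link_payoff E \<sigma> i j x (g $ j $ i) \<le> link_payoff E \<sigma> i j (g $ i $ j) (g $ j $ i))))"
    unfolding optimal_links_def link_profiles_def by (auto; metis order_refl)
  also have "\<dots> \<longleftrightarrow> (\<forall>i j. (i = j \<longrightarrow> g $ i $ j = 0) \<and> (i \<noteq> j \<longrightarrow> g $ i $ j =
      max 0 ((link_value E $ i $ j + \<sigma> $ i $ j) / link_cost E $ i $ j)))"
  proof -
    have "link_payoff E \<sigma> i j x y \<le> link_payoff E \<sigma> i j z y \<longleftrightarrow>
        (link_value E $ i $ j + \<sigma> $ i $ j) * x - link_cost E $ i $ j * x\<^sup>2 / 2
        \<le> (link_value E $ i $ j + \<sigma> $ i $ j) * z - link_cost E $ i $ j * z\<^sup>2 / 2" for i j x y z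
      by (simp add: link_payoff_def algebra_simps)
    then have iff: "0 \<le> g $ i $ j \<and>
        (\<forall>x\<ge>0. link_payoff E \<sigma> i j x (g $ j $ i) \<le> link_payoff E \<sigma> i j (g $ i $ j) (g $ j $ i))
        \<longleftrightarrow> g $ i $ j = max 0 ((link_value E $ i $ j + \<sigma> $ i $ j) / link_cost E $ i $ j)"
      if "i \<noteq> j" for i j
      by (simp only: quadratic_argmax_iff[OF f[OF that]])
    show ?thesis by (intro all_cong1 conj_cong imp_cong refl iff)
  qed
  finally show ?thesis by auto
qed

section \<open>Action equilibria as solutions of a linear system\<close>

lemma network_nonneg: "g \<in> link_profiles \<Longrightarrow> 0 \<le> network g $ i $ j"
  by (simp add: network_def link_profiles_def)

lemma transpose_network: "transpose (network g) = network g"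
  by (simp add: network_def transpose_def vec_eq_iff)

lemma sum_offdiagonal_network:
  "(\<Sum>j\<in>UNIV - {i}. network g $ i $ j * x j) = (\<Sum>j\<in>UNIV. network g $ i $ j * x j)"
  by (rule sum.mono_neutral_left) (auto simp: network_def)

text \<open>Networks have zero diagonal, so \<open>c $ i\<close> does not depend on
  \<open>a $ i\<close> and the best reply is \<open>max 0 (c $ i)\<close>. Positive benefits keep
  \<open>c $ i\<close> positive at nonnegative profiles, so the truncation at 0 never binds.\<close>

lemma action_nash_iff:
  assumes pos: "\<And>i. 0 < benefit E $ i" "0 < compl E" "\<And>i. 0 \<le> \<beta> $ i"
    and g: "g \<in> link_profiles"
  shows "action_nash E \<beta> (network g) a \<longleftrightarrow>
    (\<forall>i. 0 \<le> a $ i) \<and> a = benefit E + \<beta> + compl E *\<^sub>R (network g *v a)"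
proof -
  define c where "c = benefit E + \<beta> + compl E *\<^sub>R (network g *v a)"
  have payoff: "action_payoff E \<beta> (network g) (upd a i x) i = c $ i * x - 1 * x\<^sup>2 / 2" for i x
  proof -
    have "(\<Sum>j\<in>UNIV - {i}. network g $ i $ j * upd a i x $ i * upd a i x $ j)
        = (\<Sum>j\<in>UNIV - {i}. network g $ i $ j * (x * a $ j))"
      by (simp add: upd_def mult.assoc)
    also have "\<dots> = (\<Sum>j\<in>UNIV. network g $ i $ j * (x * a $ j))"
      by (rule sum_offdiagonal_network)
    also have "\<dots> = x * (network g *v a) $ i"
      by (simp add: matrix_vector_mult_def sum_distrib_left mult_ac)
    finally show ?thesis
      by (simp add: action_payoff_def c_def upd_def algebra_simps)
  qed
  have "upd a i (a $ i) = a" for i by (simp add: upd_def vec_eq_iff)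
  then have payoff_self: "action_payoff E \<beta> (network g) a i = c $ i * a $ i - 1 * (a $ i)\<^sup>2 / 2" for i
    using payoff[of i "a $ i"] by simp
  have "action_nash E \<beta> (network g) a \<longleftrightarrow>
      (\<forall>i. 0 \<le> a $ i \<and> (\<forall>x\<ge>0. c $ i * x - 1 * x\<^sup>2 / 2 \<le> c $ i * a $ i - 1 * (a $ i)\<^sup>2 / 2))"
    unfolding action_nash_def action_profiles_def payoff payoff_self by auto
  also have "\<dots> \<longleftrightarrow> (\<forall>i. a $ i = max 0 (c $ i / 1))"
    by (subst quadratic_argmax_iff) auto
  also have "\<dots> \<longleftrightarrow> (\<forall>i. 0 \<le> a $ i) \<and> a = c"
  proof -
    have c_pos: "0 < c $ i" if "\<And>i. 0 \<le> a $ i" for i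
    proof -
      have "0 \<le> (network g *v a) $ i"
        using that network_nonneg[OF g] by (auto simp: matrix_vector_mult_def intro!: sum_nonneg)
      then show ?thesis using pos(1)[of i] pos(2) pos(3)[of i] by (simp add: c_def add_pos_nonneg)
    qed
    show ?thesis
    proof
      assume max: "\<forall>i. a $ i = max 0 (c $ i / 1)"
      then have nonneg: "0 \<le> a $ i" for i by simp
      then show "(\<forall>i. 0 \<le> a $ i) \<and> a = c"
        using max c_pos[OF nonneg] by (simp add: vec_eq_iff max_absorb2 less_imp_le)
    next
      assume "(\<forall>i. 0 \<le> a $ i) \<and> a = c"
      then show "\<forall>i. a $ i = max 0 (c $ i / 1)"
        by (metis div_by_1 max_absorb2)
    qed
  qed
  finally show ?thesis by (simp add: c_def)
qed

section \<open>Equilibria and payments in a fixed environment\<close>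

context
  fixes E :: "'n::finite env"
  assumes env: "environment E"
begin

lemma environment_pos:
  "0 < benefit E $ i" "0 < compl E" "i \<noteq> j \<Longrightarrow> 0 < link_cost E $ i $ j"
  using env by (auto simp: environment_def)

lemma environment_sym:
  "i \<noteq> j \<Longrightarrow> link_value E $ i $ j = link_value E $ j $ i"
  "i \<noteq> j \<Longrightarrow> link_cost E $ i $ j = link_cost E $ j $ i"
  using env by (auto simp: environment_def)

lemma env_optimal_links_iff:
  "optimal_links E \<sigma> g \<longleftrightarrow> (\<forall>i j. g $ i $ j =
    (if i = j then 0 else max 0 ((link_value E $ i $ j + \<sigma> $ i $ j) / link_cost E $ i $ j)))"
  by (rule optimal_links_iff) (rule environment_pos(3))

lemma equilibrium_iff:
  assumes "\<And>i. 0 \<le> \<beta> $ i"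
  shows "equilibrium E \<beta> \<sigma> a g \<longleftrightarrow> optimal_links E \<sigma> g \<and>
    (\<forall>i. 0 \<le> a $ i) \<and> a = benefit E + \<beta> + compl E *\<^sub>R (network g *v a)"
  using action_nash_iff[OF environment_pos(1,2) assms]
  by (auto simp: equilibrium_def optimal_links_def)

text \<open>Positive benefits make equilibrium actions strictly subinvariant under their own
  weighted network, so \<open>a\<close> itself meets the hypotheses of the minimum
  principle.\<close>

lemma equilibriumD:
  assumes \<beta>: "\<And>i. 0 \<le> \<beta> $ i" and eq: "equilibrium E \<beta> \<sigma> a g"
  shows "a = benefit E + \<beta> + compl E *\<^sub>R network g *v a"
    and "0 \<le> (compl E *\<^sub>R network g) $ i $ j" "0 < a $ i"
    and "(compl E *\<^sub>R network g *v a) $ i < a $ i"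
proof -
  let ?M = "compl E *\<^sub>R network g"
  have a: "\<And>i. 0 \<le> a $ i" "a = benefit E + \<beta> + ?M *v a"
    using eq by (auto simp: equilibrium_iff[OF \<beta>] scaleR_matrix_vector_assoc)
  show "a = benefit E + \<beta> + ?M *v a" by (fact a(2))
  have M: "0 \<le> ?M $ i $ j" for i j
    using eq environment_pos(2) network_nonneg[of g] by (simp add: equilibrium_def optimal_links_def)
  then show "0 \<le> ?M $ i $ j" .
  have "0 \<le> (?M *v a) $ i"
    using M a(1) unfolding matrix_vector_mult_def by (simp add: sum_nonneg)
  moreover have "a $ i = benefit E $ i + \<beta> $ i + (?M *v a) $ i"
    using a(2) by (metis vector_add_component)
  ultimately show "(?M *v a) $ i < a $ i" "0 < a $ i"
    using environment_pos(1)[of i] \<beta>[of i] by linarith+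
qed

lemma equilibrium_unique:
  assumes \<beta>: "\<And>i. 0 \<le> \<beta> $ i"
    and eq: "equilibrium E \<beta> \<sigma> a g" "equilibrium E \<beta> \<sigma> a' g'"
  shows "a' = a" "g' = g"
proof -
  show g: "g' = g"
    using eq by (simp add: equilibrium_def env_optimal_links_iff vec_eq_iff)
  show "a' = a"
    using unique_fixed_point_if_subinvariant[OF equilibriumD(2-4)[OF \<beta> eq(1)]]
      equilibriumD(1)[OF \<beta> eq(1)] equilibriumD(1)[OF \<beta> eq(2)] g by blast
qed

text \<open>Uniqueness makes the selection immaterial: any equilibrium that is exhibited is the
  selected one.\<close>

lemma selected_equilibrium:
  assumes sub: "(\<beta>, \<sigma>) \<in> subsidies" and eq: "equilibrium E \<beta> \<sigma> a g"
  shows "eq_action E \<beta> \<sigma> = a" "eq_network E \<beta> \<sigma> = network g"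
proof -
  have "has_equilibrium E \<beta> \<sigma>" using eq by (auto simp: has_equilibrium_def)
  with sub env have "equilibrium E \<beta> \<sigma> (fst (selection E \<beta> \<sigma>)) (snd (selection E \<beta> \<sigma>))"
    unfolding environment_def by blast
  moreover have "\<And>i. 0 \<le> \<beta> $ i" using sub by (simp add: subsidies_def)
  ultimately show "eq_action E \<beta> \<sigma> = a" "eq_network E \<beta> \<sigma> = network g"
    using equilibrium_unique eq unfolding eq_action_def eq_network_def by blast+
qed

lemma payment_eq:
  assumes sub: "(\<beta>, \<sigma>) \<in> subsidies" and eq: "equilibrium E \<beta> \<sigma> a g"
  shows "payment E \<beta> \<sigma> = \<beta> \<bullet> a + (\<Sum>i\<in>UNIV. \<Sum>j\<in>UNIV. \<sigma> $ i $ j * network g $ i $ j)"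
  using sum_offdiagonal_network[of g _ "\<lambda>j. \<sigma> $ _ $ j"]
  by (simp add: payment_def selected_equilibrium[OF assms] inner_vec_def mult.commute)

lemma link_subsidy_le_payment:
  assumes sub: "(\<beta>, \<sigma>) \<in> subsidies" and eq: "equilibrium E \<beta> \<sigma> a g"
  shows "\<sigma> $ i $ j * network g $ i $ j \<le> payment E \<beta> \<sigma>"
proof -
  have nonneg: "\<And>i. 0 \<le> \<beta> $ i" "\<And>i j. 0 \<le> \<sigma> $ i $ j"
    using sub by (auto simp: subsidies_def)
  have G: "0 \<le> network g $ i $ j" for i j
    using eq network_nonneg by (auto simp: equilibrium_def optimal_links_def)
  have a: "0 \<le> a $ i" for i using equilibriumD(3)[OF nonneg(1) eq] by (rule less_imp_le)
  have "\<sigma> $ i $ j * network g $ i $ j \<le> (\<Sum>j\<in>UNIV. \<sigma> $ i $ j * network g $ i $ j)"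
    using nonneg G by (intro member_le_sum) auto
  also have "\<dots> \<le> (\<Sum>i\<in>UNIV. \<Sum>j\<in>UNIV. \<sigma> $ i $ j * network g $ i $ j)"
    using nonneg G by (intro member_le_sum[of i UNIV "\<lambda>i. \<Sum>j\<in>UNIV. \<sigma> $ i $ j * network g $ i $ j"])
      (auto intro!: sum_nonneg)
  also have "\<dots> \<le> payment E \<beta> \<sigma>"
    using nonneg a by (simp add: payment_eq[OF assms] inner_vec_def sum_nonneg)
  finally show ?thesis .
qed

text \<open>The improving deviation raises \<open>\<sigma> $ i $ k\<close> and lowers \<open>\<beta> $ i\<close> so that the incentive of \<open>i\<close> is
  exactly preserved; hence the equilibrium moves from \<open>a\<close> to \<open>a' = a + t w\<close>, where \<open>w\<close> is the
  response to a unit increase of the benefit of \<open>k\<close>. Let \<open>M\<close> be the weighted network. As \<open>M\<close> is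
  symmetric, \<open>a $ k = w \<bullet> (benefit E + \<beta>)\<close>, so that the expenditure on \<open>\<beta>\<close> falls by at least
  \<open>t * (w \<bullet> benefit E)\<close>.\<close>

lemma improving_subsidy:
  assumes sub: "(\<beta>, \<sigma>) \<in> subsidies" and eq: "equilibrium E \<beta> \<sigma> a g"
    and ik: "i \<noteq> k" and \<beta>i: "0 < \<beta> $ i" and active: "0 \<le> link_value E $ i $ k + \<sigma> $ i $ k"
    and cheap: "link_cost E $ i $ k * (network g $ i $ k + 1) + \<sigma> $ i $ k + \<sigma> $ k $ i
      \<le> compl E * a $ i * benefit E $ k"
  obtains \<beta>' \<sigma>' a' g' where "(\<beta>', \<sigma>') \<in> subsidies" "equilibrium E \<beta>' \<sigma>' a' g'"
    "payment E \<beta>' \<sigma>' \<le> payment E \<beta> \<sigma>" "\<And>j. a $ j \<le> a' $ j" "a $ k < a' $ k"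
proof -
  define \<rho> G f b where "\<rho> = compl E" and "G = network g" and "f = link_cost E $ i $ k"
    and "b = benefit E"
  define M where "M = \<rho> *\<^sub>R G"
  have nonneg: "\<And>j. 0 \<le> \<beta> $ j" "\<And>p q. 0 \<le> \<sigma> $ p $ q" "\<And>p. \<sigma> $ p $ p = 0"
    using sub by (auto simp: subsidies_def)
  note eqD = equilibriumD[OF nonneg(1) eq, folded \<rho>_def G_def b_def, folded M_def]
  have pos: "0 < \<rho>" "0 < f" "\<And>j. 0 < b $ j" "0 < a $ i" "0 < a $ k"
    using environment_pos ik eqD(3) by (auto simp: \<rho>_def f_def b_def)
  have links: "optimal_links E \<sigma> g" using eq by (simp add: equilibrium_def)
  obtain w where w: "w = axis k 1 + M *v w" and wnn: "\<And>j. 0 \<le> w $ j"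
  proof (rule ex_fixed_point_if_subinvariant[OF eqD(2-4)])
    show "0 \<le> axis k (1 :: real) $ j" for j by (simp add: axis_def)
  qed blast
  have Mw: "0 \<le> (M *v w) $ k"
    using eqD(2) wnn unfolding matrix_vector_mult_def by (simp add: sum_nonneg)
  have "w $ k = 1 + (M *v w) $ k"
    by (subst w) (simp add: axis_def)
  then have wk: "1 \<le> w $ k" using Mw by linarith

  \<comment> \<open>The three bounds serve for \<open>a' $ k \<le> a $ k + w $ k\<close>,
    \<open>\<eta> \<le> 1\<close> and \<open>0 \<le> \<beta>' $ i\<close>, in this order.\<close>
  define t where "t = min (min 1 (\<rho> * a $ i)) (\<beta> $ i * a $ i / (a $ k + w $ k))"
  have "0 < a $ k + w $ k" using pos wk by linarith
  then have t: "0 < t" "t \<le> 1" "t \<le> \<rho> * a $ i" "t * (a $ k + w $ k) \<le> \<beta> $ i * a $ i"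
    using pos \<beta>i by (auto simp: t_def min_less_iff_conj simp flip: pos_le_divide_eq)
  define a' where "a' = a + t *\<^sub>R w"
  have a'_ge: "a $ j \<le> a' $ j" for j
    using t(1) wnn[of j] by (simp add: a'_def)
  have a'_k: "a $ k < a' $ k" "a' $ k \<le> a $ k + w $ k"
    using t wk by (auto simp: a'_def mult_left_le_one_le)
  have a'_i: "0 < a' $ i" using pos(4) a'_ge[of i] by linarith
  \<comment> \<open>The increase of the weighted link between \<open>i\<close> and \<open>k\<close>,
    chosen so that at the new action of \<open>i\<close> the incentive of \<open>k\<close> gains
    exactly \<open>t\<close> from it.\<close>
  define h where "h = t / a' $ i"
  have h: "0 < h" "h * a' $ i = t" using t(1) a'_i by (auto simp: h_def)
  have ha: "h * a $ i \<le> t"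
    using h a'_ge[of i] by (metis mult_left_mono less_imp_le)
  define \<eta> where "\<eta> = h / \<rho>"
  have \<eta>: "0 < \<eta>" "\<rho> * \<eta> = h" using h(1) pos(1) by (auto simp: \<eta>_def)
  have "h * a $ i \<le> \<rho> * a $ i" using ha t(3) by linarith
  then have "\<eta> \<le> 1" using pos by (simp add: \<eta>_def)

  \<comment> \<open>The amount removed is what the stronger link adds to the incentive of
    \<open>i\<close> at the new actions.\<close>
  define \<beta>' where "\<beta>' = \<beta> - axis i (h * a' $ k)"
  \<comment> \<open>As \<open>active\<close> rules out truncation at 0, raising the subsidy by
    \<open>f * \<eta>\<close> raises the intensity by exactly \<open>\<eta>\<close>.\<close>
  define \<sigma>' where "\<sigma>' = (\<chi> p q. \<sigma> $ p $ q + (if p = i \<and> q = k then f * \<eta> else 0))"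
  define g' where "g' = (\<chi> p q. g $ p $ q + (if p = i \<and> q = k then \<eta> else 0))"

  have "h * a' $ k * a $ i \<le> \<beta> $ i * a $ i"
  proof -
    have "h * a' $ k * a $ i = (h * a $ i) * a' $ k" by simp
    also have "\<dots> \<le> t * (a $ k + w $ k)"
      using ha a'_k pos(5) t(1) by (intro mult_mono) auto
    finally show ?thesis using t(4) by linarith
  qed
  then have "h * a' $ k \<le> \<beta> $ i" using pos(4) by simp
  then have \<beta>'nn: "0 \<le> \<beta>' $ j" for j
    using nonneg(1) by (auto simp: \<beta>'_def axis_def)
  have sub': "(\<beta>', \<sigma>') \<in> subsidies"
    using \<beta>'nn nonneg ik pos(2) \<eta>(1) by (auto simp: subsidies_def \<sigma>'_def)

  have G': "network g' $ p $ q = G $ p $ q + (if p = i \<and> q = k then \<eta> else 0)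
      + (if p = k \<and> q = i then \<eta> else 0)" for p q
    using ik by (auto simp: network_def g'_def G_def)
  have M': "\<rho> *\<^sub>R (network g' *v x) = M *v x + axis i (h * x $ k) + axis k (h * x $ i)" for x
  proof -
    have "(\<rho> *\<^sub>R (network g' *v x)) $ p = (M *v x + axis i (h * x $ k) + axis k (h * x $ i)) $ p" for p
    proof -
      have "(network g' *v x) $ p = (G *v x) $ p
          + (\<Sum>q\<in>UNIV. if q = k then if p = i then \<eta> * x $ k else 0 else 0)
          + (\<Sum>q\<in>UNIV. if q = i then if p = k then \<eta> * x $ i else 0 else 0)"
        unfolding matrix_vector_mult_def vec_lambda_beta G' sum.distrib[symmetric]
        by (rule sum.cong) (auto simp: algebra_simps)
      then show ?thesis
        using ik \<eta>(2) by (auto simp: M_def axis_def algebra_simps simp flip: scaleR_matrix_vector_assoc)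
    qed
    then show ?thesis by (simp add: vec_eq_iff)
  qed

  have links': "optimal_links E \<sigma>' g'"
  proof -
    have "g $ i $ k = (link_value E $ i $ k + \<sigma> $ i $ k) / f"
      using links active ik pos(2) by (simp add: env_optimal_links_iff f_def max_def)
    then have "g' $ i $ k = max 0 ((link_value E $ i $ k + \<sigma>' $ i $ k) / f)"
      using pos(2) \<eta>(1) active by (simp add: g'_def \<sigma>'_def max_def field_simps)
    moreover have "g' $ p $ q = g $ p $ q" "\<sigma>' $ p $ q = \<sigma> $ p $ q" if "\<not> (p = i \<and> q = k)" for p q
      using that by (auto simp: g'_def \<sigma>'_def)
    moreover have "g $ p $ q = (if p = q then 0
        else max 0 ((link_value E $ p $ q + \<sigma> $ p $ q) / link_cost E $ p $ q))" for p q
      using links unfolding env_optimal_links_iff by blast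
    ultimately have "g' $ p $ q = (if p = q then 0
        else max 0 ((link_value E $ p $ q + \<sigma>' $ p $ q) / link_cost E $ p $ q))" for p q
      using ik unfolding f_def by (cases "p = i \<and> q = k") auto
    then show ?thesis unfolding env_optimal_links_iff by blast
  qed
  \<comment> \<open>The equation of \<open>a\<close> plus \<open>t\<close> times that of
    \<open>w\<close>; the surplus \<open>t\<close> at \<open>k\<close> is then supplied by the
    stronger link.\<close>
  have "a' = (b + \<beta> + M *v a) + t *\<^sub>R (axis k 1 + M *v w)"
    unfolding a'_def using eqD(1) w by simp
  also have "\<dots> = b + \<beta> + M *v a' + axis k t"
    by (simp add: a'_def matrix_vector_right_distrib matrix_vector_mult_scaleR algebra_simps)
      (simp add: axis_def vec_eq_iff)
  also have "\<dots> = b + \<beta>' + \<rho> *\<^sub>R (network g' *v a')"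
    by (simp add: M' \<beta>'_def h(2))
  finally have response: "a' = b + \<beta>' + \<rho> *\<^sub>R (network g' *v a')" .
  have "0 \<le> a' $ j" for j
    using eqD(3)[of j] a'_ge[of j] by linarith
  then have eq': "equilibrium E \<beta>' \<sigma>' a' g'"
    unfolding equilibrium_iff[OF \<beta>'nn] using links' response by (simp add: b_def \<rho>_def)

  have transp: "transpose M = M"
    using transpose_network[of g] by (simp add: M_def G_def transpose_def vec_eq_iff)
  have "a $ k = a \<bullet> (w - M *v w)"
    by (subst w) (simp add: inner_axis)
  also have "\<dots> = w \<bullet> (a - M *v a)"
  proof -
    have "a \<bullet> (M *v w) = w \<bullet> (M *v a)"
      by (metis transp dot_lmul_matrix inner_commute transpose_matrix_vector)
    then show ?thesis by (simp add: inner_diff_right inner_commute)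
  qed
  also have "a - M *v a = b + \<beta>"
    using eqD(1) by (metis add_diff_cancel_right')
  finally have a_k: "a $ k = b \<bullet> w + \<beta> \<bullet> w"
    by (simp add: inner_right_distrib inner_commute)
  have "b $ k \<le> b $ k * w $ k" using pos(3)[of k] wk by simp
  also have "\<dots> \<le> b \<bullet> w"
    unfolding inner_vec_def inner_real_def
    using less_imp_le[OF pos(3)] wnn by (intro member_le_sum mult_nonneg_nonneg) auto
  finally have bw: "b $ k \<le> b \<bullet> w" .
  have "\<beta>' \<bullet> a' = \<beta> \<bullet> a + t * (\<beta> \<bullet> w) - (h * a' $ i) * a' $ k"
    by (simp add: \<beta>'_def inner_diff_left inner_axis' a'_def inner_right_distrib algebra_simps)
  also have "\<dots> = \<beta> \<bullet> a - t * (a' $ k - \<beta> \<bullet> w)"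
    unfolding h(2) by (simp add: algebra_simps)
  also have "\<dots> \<le> \<beta> \<bullet> a - t * b $ k"
    using t(1) bw a_k a'_k(1) by simp
  finally have action_saving: "\<beta>' \<bullet> a' \<le> \<beta> \<bullet> a - t * b $ k" .

  \<comment> \<open>Two entries change: \<open>(i, k)\<close>, where subsidy and link both grow, and
    \<open>(k, i)\<close>, where the old subsidy is paid on a stronger link.\<close>
  have "(\<Sum>p\<in>UNIV. \<Sum>q\<in>UNIV. \<sigma>' $ p $ q * network g' $ p $ q)
      = (\<Sum>p\<in>UNIV. \<Sum>q\<in>UNIV. \<sigma> $ p $ q * G $ p $ q
        + (if q = k then if p = i then \<eta> * (f * G $ i $ k + \<sigma> $ i $ k + f * \<eta>) else 0 else 0)
        + (if q = i then if p = k then \<eta> * \<sigma> $ k $ i else 0 else 0))"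
    using ik by (intro sum.cong refl) (auto simp: G' \<sigma>'_def algebra_simps)
  also have "\<dots> = (\<Sum>p\<in>UNIV. \<Sum>q\<in>UNIV. \<sigma> $ p $ q * G $ p $ q)
      + \<eta> * (f * (G $ i $ k + \<eta>) + \<sigma> $ i $ k + \<sigma> $ k $ i)"
    by (simp add: sum.distrib algebra_simps)
  finally have link_change: "(\<Sum>p\<in>UNIV. \<Sum>q\<in>UNIV. \<sigma>' $ p $ q * network g' $ p $ q)
      = (\<Sum>p\<in>UNIV. \<Sum>q\<in>UNIV. \<sigma> $ p $ q * G $ p $ q)
      + \<eta> * (f * (G $ i $ k + \<eta>) + \<sigma> $ i $ k + \<sigma> $ k $ i)" .
  \<comment> \<open>With \<open>\<eta> \<le> 1\<close>, the assumption \<open>cheap\<close> bounds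
    the extra link expenditure by \<open>h * a $ i * b $ k\<close>, which is at most the saving
    \<open>t * b $ k\<close>.\<close>
  have "f * (G $ i $ k + \<eta>) \<le> f * (G $ i $ k + 1)"
    using pos(2) \<open>\<eta> \<le> 1\<close> by simp
  then have "\<eta> * (f * (G $ i $ k + \<eta>) + \<sigma> $ i $ k + \<sigma> $ k $ i) \<le> \<eta> * (\<rho> * a $ i * b $ k)"
    using cheap \<eta>(1) unfolding \<rho>_def f_def G_def b_def by (intro mult_left_mono) auto
  also have "\<dots> = h * a $ i * b $ k" using \<eta>(2) by (metis mult.assoc mult.commute)
  also have "\<dots> \<le> t * b $ k"
    using ha pos(3)[of k] by simp
  finally have "payment E \<beta>' \<sigma>' \<le> payment E \<beta> \<sigma>"
    using action_saving link_change
    by (simp add: payment_eq[OF sub eq] payment_eq[OF sub' eq'] G_def)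
  with sub' eq' a'_ge a'_k(1) that show thesis by blast
qed

text \<open>Otherwise the substitution of \<open>improving_subsidy\<close> would be affordable and
  strictly better.\<close>

lemma optimal_action_subsidy_zero:
  assumes opt: "optimal_subsidy E \<beta> \<sigma>" and eq: "equilibrium E \<beta> \<sigma> a g"
    and ik: "i \<noteq> k" and active: "0 \<le> link_value E $ i $ k + \<sigma> $ i $ k"
    and cheap: "link_cost E $ i $ k * (network g $ i $ k + 1) + \<sigma> $ i $ k + \<sigma> $ k $ i
      \<le> compl E * a $ i * benefit E $ k"
  shows "\<beta> $ i = 0"
proof (rule ccontr)
  have sub: "(\<beta>, \<sigma>) \<in> subsidies" using opt by (simp add: optimal_subsidy_def)
  assume "\<beta> $ i \<noteq> 0"
  moreover have \<beta>: "\<And>j. 0 \<le> \<beta> $ j" using sub by (simp add: subsidies_def)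
  ultimately have \<beta>i: "0 < \<beta> $ i" by (metis order_le_less)
  obtain \<beta>' \<sigma>' a' g' where sub': "(\<beta>', \<sigma>') \<in> subsidies" and eq': "equilibrium E \<beta>' \<sigma>' a' g'"
    and pay: "payment E \<beta>' \<sigma>' \<le> payment E \<beta> \<sigma>"
    and better: "\<And>j. a $ j \<le> a' $ j" "a $ k < a' $ k"
    using improving_subsidy[OF sub eq ik \<beta>i active cheap] by blast
  have "affordable E \<beta>' \<sigma>'"
    using pay opt by (simp add: affordable_def optimal_subsidy_def)
  then have "subsidy_welfare E \<beta>' \<sigma>' \<le> subsidy_welfare E \<beta> \<sigma>"
    using opt sub' unfolding optimal_subsidy_def by blast
  moreover have "has_equilibrium E \<beta> \<sigma>" "has_equilibrium E \<beta>' \<sigma>'"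
    using eq eq' by (auto simp: has_equilibrium_def)
  ultimately have "welfare E a' \<le> welfare E a"
    by (simp add: subsidy_welfare_def selected_equilibrium(1)[OF sub eq]
        selected_equilibrium(1)[OF sub' eq'])
  moreover have "welfare E a < welfare E a'"
  proof (rule welfare_strict_mono[OF _ _ better])
    show "strictly_increasing_in_each (welfare E)" using env by (simp add: environment_def)
    show "a \<in> action_profiles"
      using equilibriumD(3)[OF \<beta> eq] by (auto simp: action_profiles_def intro: less_imp_le)
  qed
  ultimately show False by linarith
qed

text \<open>Each end's action exceeds the weighted link times the other end's action; adding the two
  inequalities allows cancelling \<open>a $ i + a $ k\<close>. Once the complementarity is bounded
  below, this bounds every link uniformly.\<close>

lemma weighted_link_le_1:
  assumes \<beta>: "\<And>i. 0 \<le> \<beta> $ i" and eq: "equilibrium E \<beta> \<sigma> a g"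
  shows "compl E * network g $ i $ k \<le> 1"
proof -
  note eqD = equilibriumD[OF assms]
  let ?M = "compl E *\<^sub>R network g"
  have le: "?M $ p $ q * a $ q \<le> a $ p" for p q
  proof -
    have "?M $ p $ q * a $ q \<le> (?M *v a) $ p"
      unfolding matrix_vector_mult_def vec_lambda_beta
      using eqD(2) less_imp_le[OF eqD(3)] by (intro member_le_sum mult_nonneg_nonneg) auto
    then show ?thesis using eqD(4)[of p] by linarith
  qed
  have "network g $ k $ i = network g $ i $ k" by (auto simp: network_def)
  then have "compl E * network g $ i $ k * (a $ i + a $ k) \<le> 1 * (a $ i + a $ k)"
    using le[of i k] le[of k i] by (simp add: algebra_simps)
  moreover have "0 < a $ i + a $ k" using eqD(3)[of i] eqD(3)[of k] by linarith
  ultimately show ?thesis by (rule mult_right_le_imp_le)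
qed

text \<open>With \<open>S\<close> the sum of the two subsidies,
  \<open>f * G = 2 * s + S \<ge> S\<close>, while \<open>S * G\<close> is at most twice the payment;
  hence \<open>S\<^sup>2\<close> is at most \<open>2 * f\<close> times the payment. Passing through
  \<open>S \<le> 1 + S\<^sup>2\<close> avoids a square root.\<close>

lemma link_subsidy_bound:
  assumes sub: "(\<beta>, \<sigma>) \<in> subsidies" and eq: "equilibrium E \<beta> \<sigma> a g"
    and ik: "i \<noteq> k" and s: "0 \<le> link_value E $ i $ k"
  shows "\<sigma> $ i $ k + \<sigma> $ k $ i \<le> 1 + 2 * link_cost E $ i $ k * payment E \<beta> \<sigma>"
proof -
  let ?S = "\<sigma> $ i $ k + \<sigma> $ k $ i" and ?f = "link_cost E $ i $ k" and ?G = "network g $ i $ k"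
  have \<sigma>: "0 \<le> \<sigma> $ p $ q" for p q using sub by (simp add: subsidies_def)
  have f: "0 < ?f" using environment_pos(3)[OF ik] .
  have link: "g $ p $ q = (link_value E $ p $ q + \<sigma> $ p $ q) / link_cost E $ p $ q"
    if "p \<noteq> q" "0 \<le> link_value E $ p $ q" for p q
  proof -
    have "0 \<le> (link_value E $ p $ q + \<sigma> $ p $ q) / link_cost E $ p $ q"
      using that \<sigma> environment_pos(3) by (intro divide_nonneg_pos add_nonneg_nonneg)
    then show ?thesis
      using eq that(1) by (simp add: equilibrium_def env_optimal_links_iff max_absorb2)
  qed
  have g: "g $ i $ k = (link_value E $ i $ k + \<sigma> $ i $ k) / ?f"
    "g $ k $ i = (link_value E $ i $ k + \<sigma> $ k $ i) / ?f"
    using link[of i k] link[of k i] ik s environment_sym[OF ik] by auto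
  have "?f * ?G = 2 * link_value E $ i $ k + ?S"
    using ik f by (simp add: network_def g field_simps)
  then have "?S * ?S \<le> ?S * (?f * ?G)"
    using s \<sigma> by (intro mult_left_mono) (auto intro: add_nonneg_nonneg)
  moreover have "?S * ?G \<le> 2 * payment E \<beta> \<sigma>"
    using link_subsidy_le_payment[OF sub eq, of i k] link_subsidy_le_payment[OF sub eq, of k i]
    by (simp add: network_def algebra_simps split: if_splits)
  then have "?f * (?S * ?G) \<le> ?f * (2 * payment E \<beta> \<sigma>)"
    using f by (intro mult_left_mono) auto
  ultimately have "?S * ?S \<le> 2 * ?f * payment E \<beta> \<sigma>"
    by (simp add: mult_ac)
  moreover have "0 \<le> (?S - 1) * (?S - 1) + ?S"
    using \<sigma> by simp
  ultimately show ?thesis by (simp add: algebra_simps)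
qed

end

section \<open>Uniform bounds along the sequence of environments\<close>

theorem theorem2:
  fixes E :: "nat \<Rightarrow> 'n::finite env"
    and G0 :: "nat \<Rightarrow> real^'n^'n"
    and b_lo b_hi f_lo f_hi \<rho>_lo B_hi \<delta> :: real
    and L :: nat
  assumes env: "\<And>m. environment (E m)"
    and b_bounds: "0 < b_lo" "b_lo \<le> b_hi" "\<And>m i. benefit (E m) $ i \<in> {b_lo..b_hi}"
    and f_bounds: "0 < f_lo" "f_lo \<le> f_hi"
      "\<And>m i j. i \<noteq> j \<Longrightarrow> link_cost (E m) $ i $ j \<in> {f_lo..f_hi}"
    and rho_bound: "0 < \<rho>_lo" "\<And>m. \<rho>_lo \<le> compl (E m)"
    and budget_bound: "\<And>m. budget (E m) \<le> B_hi"
    and zero_network: "\<And>m. zero_subsidy_network (E m) (G0 m)"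
    and primitive: "0 < \<delta>"
      "\<And>m i j. \<delta> \<le> mat_power (G0 m) L $ i $ j / (spectral_radius (G0 m)) ^ L"
    and critical: "(\<lambda>m. spectral_radius (compl (E m) *\<^sub>R G0 m)) \<longlonglongrightarrow> 1"
  shows "eventually (\<lambda>m. \<forall>\<beta> \<sigma>. optimal_subsidy (E m) \<beta> \<sigma> \<longrightarrow> (\<forall>i. \<beta> $ i = 0)) sequentially"
proof -
  \<comment> \<open>\<open>K\<close> bounds the marginal cost of strengthening an active link, the left-hand side of
    assumption \<open>cheap\<close> of \<open>optimal_action_subsidy_zero\<close>.\<close>
  define K where "K = f_hi / \<rho>_lo + f_hi + (1 + 2 * f_hi * B_hi)"
  define \<mu> where "\<mu> m = spectral_radius (compl (E m) *\<^sub>R G0 m)" for m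
  have \<mu>: "\<mu> \<longlonglongrightarrow> 1" using critical by (simp add: \<mu>_def[abs_def])
  have "\<forall>\<^sub>F m in sequentially. 0 < \<mu> m"
    using order_tendstoD(1)[OF \<mu>, of 0] by simp
  \<comment> \<open>By \<open>primitive_subinvariant_lower_bound\<close>, positivity of this
    difference forces every equilibrium action above \<open>K / (\<rho>_lo * b_lo)\<close>; its
    limit is \<open>\<delta> * b_lo\<close>.\<close>
  moreover have "\<forall>\<^sub>F m in sequentially. 0 < \<delta> * \<mu> m ^ L * b_lo - (1 - \<mu> m) * (K / (\<rho>_lo * b_lo))"
  proof (rule order_tendstoD(1))
    show "(\<lambda>m. \<delta> * \<mu> m ^ L * b_lo - (1 - \<mu> m) * (K / (\<rho>_lo * b_lo)))
        \<longlonglongrightarrow> \<delta> * 1 ^ L * b_lo - (1 - 1) * (K / (\<rho>_lo * b_lo))"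
      by (intro tendsto_intros \<mu>)
    show "0 < \<delta> * 1 ^ L * b_lo - (1 - 1) * (K / (\<rho>_lo * b_lo))"
      using primitive(1) b_bounds(1) by simp
  qed
  ultimately show ?thesis
  proof eventually_elim
    case (elim m)
    show ?case
    proof (intro allI impI)
      fix \<beta> \<sigma> i
      assume opt: "optimal_subsidy (E m) \<beta> \<sigma>"
      let ?\<rho> = "compl (E m)"
      have sub: "(\<beta>, \<sigma>) \<in> subsidies" and pay: "payment (E m) \<beta> \<sigma> \<le> B_hi"
        using opt budget_bound[of m] by (auto simp: optimal_subsidy_def)
      have \<beta>: "\<And>j. 0 \<le> \<beta> $ j" and \<sigma>: "\<And>p q. 0 \<le> \<sigma> $ p $ q"
        using sub by (auto simp: subsidies_def)
      obtain a g where eq: "equilibrium (E m) \<beta> \<sigma> a g"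
        using opt by (auto simp: optimal_subsidy_def has_equilibrium_def)
      obtain g0 where g0: "optimal_links (E m) 0 g0" "G0 m = network g0"
        using zero_network[of m] by (auto simp: zero_subsidy_network_def)
      note eqD = equilibriumD[OF env \<beta> eq]
      have \<rho>: "0 < ?\<rho>" using environment_pos(2)[OF env] .
      have G0_nonneg: "0 \<le> G0 m $ p $ q" for p q
        unfolding g0(2) using g0(1) by (intro network_nonneg) (simp add: optimal_links_def)
      have G0_sym: "transpose (G0 m) = G0 m" by (simp add: g0(2) transpose_network)
      have g0_le: "g0 $ p $ q \<le> g $ p $ q" for p q
      proof -
        have "g0 $ p $ q = (if p = q then 0 else max 0 (link_value (E m) $ p $ q / link_cost (E m) $ p $ q))"
          using g0(1) by (simp add: env_optimal_links_iff[OF env])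
        moreover have "g $ p $ q = (if p = q then 0
            else max 0 ((link_value (E m) $ p $ q + \<sigma> $ p $ q) / link_cost (E m) $ p $ q))"
          using eq by (simp add: equilibrium_def env_optimal_links_iff[OF env])
        moreover have "link_value (E m) $ p $ q / link_cost (E m) $ p $ q
            \<le> (link_value (E m) $ p $ q + \<sigma> $ p $ q) / link_cost (E m) $ p $ q" if "p \<noteq> q"
          using environment_pos(3)[OF env[of m] that] \<sigma> by (intro divide_right_mono) auto
        ultimately show ?thesis by (auto intro: max.mono)
      qed
      have G0_le: "G0 m $ p $ q \<le> network g $ p $ q" for p q
        by (simp add: g0(2) network_def g0_le add_mono)
      \<comment> \<open>Subsidies only strengthen links, so the actions under the subsidised network
        are subinvariant under the zero-subsidy one, with slack \<open>b_lo\<close>.\<close>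
      have sup: "?\<rho> * (G0 m *v a) $ j + b_lo \<le> a $ j" for j
      proof -
        have "(G0 m *v a) $ j \<le> (network g *v a) $ j"
          using G0_nonneg G0_le eqD(3) by (intro matrix_vector_mult_mono) (auto intro: less_imp_le)
        then have "?\<rho> * (G0 m *v a) $ j \<le> (?\<rho> *\<^sub>R network g *v a) $ j"
          using \<rho> by (simp flip: scaleR_matrix_vector_assoc)
        moreover have "a $ j = benefit (E m) $ j + \<beta> $ j + (?\<rho> *\<^sub>R network g *v a) $ j"
          by (metis eqD(1) vector_add_component)
        ultimately show ?thesis
          using b_bounds(3)[where m = m and i = j] \<beta>[of j] by simp
      qed
      note bound = primitive_subinvariant_lower_bound[OF G0_sym G0_nonneg \<rho> b_bounds(1)
          less_imp_le[OF primitive(1)] elim(1)[unfolded \<mu>_def] primitive(2) eqD(3) sup, folded \<mu>_def]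
      have "(1 - \<mu> m) * (K / (\<rho>_lo * b_lo)) < (1 - \<mu> m) * a $ i"
        using elim(2) bound(2)[of i] by linarith
      then have "K / (\<rho>_lo * b_lo) < a $ i"
        by (rule mult_left_less_imp_less) (use bound(1) in simp)
      then have a_large: "K \<le> \<rho>_lo * a $ i * b_lo"
        using rho_bound(1) b_bounds(1) by (simp add: field_simps)

      \<comment> \<open>If \<open>i\<close> were isolated, row \<open>i\<close> of every positive
        power would vanish, which forces \<open>L = 0\<close>. But \<open>mat 1\<close> has no zero
        entry only if there is a single agent, and then the network is 0, against
        \<open>0 < \<mu> m\<close>.\<close>
      have "\<exists>k. G0 m $ i $ k \<noteq> 0"
      proof (rule ccontr)
        assume "\<not> (\<exists>k. G0 m $ i $ k \<noteq> 0)"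
        then have row: "G0 m $ i $ k = 0" for k by blast
        have pos: "mat_power (G0 m) L $ p $ q \<noteq> 0" for p q
          using primitive(1) primitive(2)[of m p q] by auto
        then have "L = 0" using mat_power_zero_row[OF row] by blast
        then have "p = q" for p q :: 'n
          using pos[of p q] by (auto simp: mat_power_def mat_def split: if_splits)
        then have "G0 m $ p $ q = 0" for p q using row by metis
        then have "G0 m = 0" by (simp add: vec_eq_iff)
        then have "\<mu> m \<le> 0"
          unfolding \<mu>_def
          by (intro spectral_radius_le_if_subinvariant[where a = 1])
            (auto simp: transpose_def matrix_vector_mult_def vec_eq_iff)
        then show False using elim(1) by linarith
      qed
      then obtain k where k: "G0 m $ i $ k \<noteq> 0" by blast
      then have ik: "i \<noteq> k" by (auto simp: g0(2) network_def)
      let ?f = "link_cost (E m) $ i $ k" and ?s = "link_value (E m) $ i $ k"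
      have f: "0 < ?f" "?f \<le> f_hi"
        using f_bounds(1) f_bounds(3)[OF ik, of m] by auto
      \<comment> \<open>A negative link value, common to both ends, would leave both intensities at
        0 in the absence of subsidies.\<close>
      have s: "0 \<le> ?s"
      proof (rule ccontr)
        assume "\<not> 0 \<le> ?s"
        then have "g0 $ i $ k = 0" "g0 $ k $ i = 0"
          using g0(1) ik f environment_sym[OF env ik]
          by (auto simp: env_optimal_links_iff[OF env] max_def zero_le_divide_iff)
        then show False using k by (simp add: g0(2) network_def split: if_splits)
      qed
      have "network g $ i $ k \<le> 1 / ?\<rho>"
        using weighted_link_le_1[OF env \<beta> eq, of i k] \<rho> by (simp add: field_simps)
      also have "\<dots> \<le> 1 / \<rho>_lo"
        using rho_bound(1) rho_bound(2)[of m] by (simp add: frac_le)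
      finally have "?f * (network g $ i $ k + 1) \<le> f_hi * (1 / \<rho>_lo + 1)"
        using f rho_bound(1) network_nonneg[of g i k] eq
        by (intro mult_mono) (auto simp: equilibrium_def optimal_links_def)
      moreover have "\<sigma> $ i $ k + \<sigma> $ k $ i \<le> 1 + 2 * f_hi * B_hi"
      proof -
        have B: "0 \<le> B_hi"
          using env[of m] budget_bound[of m] by (simp add: environment_def)
        have "?f * payment (E m) \<beta> \<sigma> \<le> ?f * B_hi" using f pay by simp
        also have "\<dots> \<le> f_hi * B_hi" using f B by (intro mult_right_mono) auto
        finally show ?thesis using link_subsidy_bound[OF env sub eq ik s] by linarith
      qed
      moreover have "\<rho>_lo * a $ i * b_lo \<le> ?\<rho> * a $ i * benefit (E m) $ k"
        using rho_bound(1) rho_bound(2)[of m] b_bounds(1) b_bounds(3)[where m = m and i = k] eqD(3)[of i]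
        by (intro mult_mono) auto
      ultimately have "?f * (network g $ i $ k + 1) + \<sigma> $ i $ k + \<sigma> $ k $ i
          \<le> ?\<rho> * a $ i * benefit (E m) $ k"
        using a_large by (simp add: K_def algebra_simps)
      moreover have "0 \<le> ?s + \<sigma> $ i $ k" using s \<sigma> by simp
      ultimately show "\<beta> $ i = 0"
        using optimal_action_subsidy_zero[OF env opt eq ik] by blast
    qed
  qed
qed

end
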